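(* Let $\succ$ be a preference relation over a relation schema $R$ that is a strict partial order (irreflexive and transitive). Then for every instance $r$ of $R$ and every finite set $\Delta^+r$ of (inserted) tuples over $R$, \[\omega_{\succ}(r\cup\Delta^+r)=\omega_{\succ}(\omega_{\succ}(r)\cup\Delta^+r).\]
   Context: A relation schema $R$ determines a set $U$ of all possible tuples (a product of attribute domains, each a countably infinite set of constants or $\mathbb{Q}$). An instance of $R$ is a finite set of tuples from $U$. A preference relation over $R$ is any subset of $U\times U$ (possibly infinite). The winnow operator is defined, for every instance $r$ of $R$, by $\omega_{\succ}(r)=\{t\in r\mid\neg\exists t'\in r.\ t'\succ t\}$. *)

theory Defs
  imports Complex_Main "HOL-Library.Countable_Set"
begin

text \<open>
  The type variable \<open>'c\<close> supplies the uninterpreted constants; the two constructors keep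
  them apart from the rational numbers.
\<close>

datatype 'c attr_value = Const 'c | Rational rat

definition attribute_domain :: "'c attr_value set \<Rightarrow> bool" where
  "attribute_domain D \<longleftrightarrow>
     (\<exists>C. countable C \<and> infinite C \<and> D = Const ` C) \<or> D = range Rational"

text \<open>A schema lists the domains of its attributes, so attributes are identified by position.\<close>

type_synonym 'c schema = "'c attr_value set list"
type_synonym 'c row = "'c attr_value list"

definition relation_schema :: "'c schema \<Rightarrow> bool" where
  "relation_schema R \<longleftrightarrow> (\<forall>D \<in> set R. attribute_domain D)"

definition tuples :: "'c schema \<Rightarrow> 'c row set" where
  "tuples R = listset R"

definition is_instance :: "'c schema \<Rightarrow> 'c row set \<Rightarrow> bool" where
  "is_instance R r \<longleftrightarrow> finite r \<and> r \<subseteq> tuples R"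

text \<open>A pair \<open>(s, t)\<close> in a preference relation means that \<open>s\<close> is preferred to \<open>t\<close>.\<close>

definition preference_relation :: "'c schema \<Rightarrow> 'c row rel \<Rightarrow> bool" where
  "preference_relation R P \<longleftrightarrow> P \<subseteq> tuples R \<times> tuples R"

definition winnow :: "'c row rel \<Rightarrow> 'c row set \<Rightarrow> 'c row set" where
  "winnow P r = {t \<in> r. \<not> (\<exists>t' \<in> r. (t', t) \<in> P)}"

end

theory Submission
  imports Defs
begin

text \<open>Discarding the dominated tuples of \<open>r\<close> loses no dominating power: in a
  finite strict partial order, a tuple dominated by some element of \<open>r\<close> is dominated by
  a maximal one, and the maximal ones form \<open>winnow P r\<close>
  (\<open>winnow_dominates\<close>). Hence \<open>r\<close> and \<open>winnow P r\<close> dominate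
  the same tuples, also among those of \<open>\<Delta>\<close>, and winnowing \<open>r\<close> early
  changes nothing.\<close>

lemma winnow_dominates:
  assumes "irrefl P" and "trans P" and "finite r"
    and "u \<in> r" and "(u, t) \<in> P"
  obtains s where "s \<in> winnow P r" and "(s, t) \<in> P"
proof -
  \<comment> \<open>\<open>P\<close> may be infinite; its restriction to the finite \<open>r\<close>
    is finite and acyclic, hence well-founded. Minimal here means most preferred.\<close>
  have "irrefl (P \<inter> r \<times> r)" "trans (P \<inter> r \<times> r)"
    using assms(1,2) by (auto simp: irrefl_def trans_def)
  then have "wf (P \<inter> r \<times> r)"
    using \<open>finite r\<close> by (intro finite_acyclic_wf) (auto simp: acyclic_irrefl)
  moreover have "u \<in> {s \<in> r. (s, t) \<in> P}"
    using assms(4,5) by simp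
  ultimately obtain s where s: "s \<in> r" "(s, t) \<in> P"
    and min: "\<And>y. (y, s) \<in> P \<inter> r \<times> r \<Longrightarrow> y \<notin> {s \<in> r. (s, t) \<in> P}"
    by (rule wfE_min) blast
  \<comment> \<open>By transitivity, a tuple of \<open>r\<close> preferred to \<open>s\<close> would
    also be preferred to \<open>t\<close>, against the minimality of \<open>s\<close>.\<close>
  have "s \<in> winnow P r"
    using s min \<open>trans P\<close> by (auto simp: winnow_def dest: transD)
  with s(2) that show thesis by blast
qed

theorem theorem7:
  fixes R :: "'c schema" and P :: "'c row rel" and r \<Delta> :: "'c row set"
  assumes "relation_schema R"
    and "preference_relation R P"
    and "irrefl P" and "trans P"
    and "is_instance R r"
    and "finite \<Delta>" and "\<Delta> \<subseteq> tuples R"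
  shows "winnow P (r \<union> \<Delta>) = winnow P (winnow P r \<union> \<Delta>)"
proof -
  have "finite r"
    using assms(5) by (simp add: is_instance_def)
  have dominated_iff: "(\<exists>u \<in> winnow P r. (u, t) \<in> P) \<longleftrightarrow> (\<exists>u \<in> r. (u, t) \<in> P)" for t
  proof -
    have "winnow P r \<subseteq> r"
      by (auto simp: winnow_def)
    with winnow_dominates[OF assms(3,4) \<open>finite r\<close>, of _ t] show ?thesis
      by blast
  qed
  have mem_winnow: "t \<in> winnow P A \<longleftrightarrow> t \<in> A \<and> \<not> (\<exists>u \<in> A. (u, t) \<in> P)" for t A
    by (simp add: winnow_def)
  show ?thesis
  proof (rule set_eqI)
    fix t
    show "t \<in> winnow P (r \<union> \<Delta>) \<longleftrightarrow> t \<in> winnow P (winnow P r \<union> \<Delta>)"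
      \<comment> \<open>Both sides now demand that nothing in \<open>r\<close> or
        \<open>\<Delta>\<close> is preferred to \<open>t\<close>; under this demand
        \<open>t \<in> r\<close> and \<open>t \<in> winnow P r\<close> agree.\<close>
      unfolding mem_winnow[of t "_ \<union> _"] bex_Un dominated_iff Un_iff mem_winnow[of t r]
      by blast
  qed
qed

end
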